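(* Let $p>1$ be an integer. Every irreducible cuspidal $\mathcal{A}\mathfrak{g}'$-module is a module of intermediate series, i.e. all of its weight spaces (the eigenspaces of $L_0$) have dimension at most $1$.
   Context: Fix an integer $p>1$. $\mathfrak{g}'$ is the complex Lie algebra with basis $\{L_m\mid m\in\mathbb{Z}\}$ and brackets $[L_m,L_n]=(n-m)L_{m+n}$, $[L_m,L_r]=rL_{m+r}$, $[L_r,L_s]=0$ for $m,n\in p\mathbb{Z}$ and $r,s\in\mathbb{Z}\setminus p\mathbb{Z}$. (It is the quotient of the gap-$p$ Virasoro algebra $\mathfrak{g}$ by central elements, so $\mathfrak{g}'$-modules are $\mathfrak{g}$-modules on which these central elements act as zero.) $\mathcal{A}=\mathrm{span}_{\mathbb{C}}\{t^m\mid m\in p\mathbb{Z}\}$ is the unital associative algebra with $t^mt^n=t^{m+n}$. An $\mathcal{A}\mathfrak{g}'$-module is a $\mathfrak{g}'$-module $V$ with a compatible (unital) associative action of $\mathcal{A}$: $t^mt^nv=t^{m+n}v$, $L_mt^nv-t^nL_mv=nt^{m+n}v$, $t^nL_rv=L_rt^nv$ for all $m,n\in p\mathbb{Z}$, $r\notin p\mathbb{Z}$, $v\in V$. It is irreducible if it is nonzero and has no proper nonzero subspace stable under both $\mathfrak{g}'$ and $\mathcal{A}$. It is cuspidal if $L_0$ acts diagonalizably and there is a positive integer $k$ such that all $L_0$-eigenspaces have dimension less than $k$. *)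

theory Defs
  imports Complex_Main "HOL-Library.Poly_Mapping"
begin

section \<open>Lie algebras and their modules\<close>

locale lie_algebra = vector_space scale
  for scale :: "'f::field \<Rightarrow> 'g::ab_group_add \<Rightarrow> 'g" +
  fixes bracket :: "'g \<Rightarrow> 'g \<Rightarrow> 'g"
  assumes bracket_linear_left: "Vector_Spaces.linear scale scale (\<lambda>x. bracket x y)"
    and bracket_linear_right: "Vector_Spaces.linear scale scale (\<lambda>y. bracket x y)"
    and bracket_self: "bracket x x = 0"
    and jacobi: "bracket x (bracket y z) + bracket y (bracket z x) + bracket z (bracket x y) = 0"

locale lie_module = G: lie_algebra gscale bracket + V: vector_space scale
  for gscale :: "'f::field \<Rightarrow> 'g::ab_group_add \<Rightarrow> 'g"
    and bracket :: "'g \<Rightarrow> 'g \<Rightarrow> 'g"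
    and scale :: "'f \<Rightarrow> 'v::ab_group_add \<Rightarrow> 'v" +
  fixes act :: "'g \<Rightarrow> 'v \<Rightarrow> 'v"
  assumes act_linear_left: "Vector_Spaces.linear gscale scale (\<lambda>x. act x v)"
    and act_linear_right: "Vector_Spaces.linear scale scale (act x)"
    and act_bracket: "act (bracket x y) v = act x (act y v) - act y (act x v)"


section \<open>Finitely supported families of complex numbers indexed by the integers\<close>

text \<open>
  The space \<open>int \<Rightarrow>\<^sub>0 complex\<close> carries both the Lie algebra \<open>\<gg>'\<close> and, on the families
  supported in \<open>p\<int>\<close>, the associative algebra \<open>\<A>\<close>. The family \<open>single m 1\<close> stands for
  \<open>L\<^sub>m\<close> in the former and for \<open>t\<^sup>m\<close> in the latter.
\<close>

definition fscale :: "complex \<Rightarrow> (int \<Rightarrow>\<^sub>0 complex) \<Rightarrow> (int \<Rightarrow>\<^sub>0 complex)" where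
  "fscale c x = Poly_Mapping.map ((*) c) x"

lemma lookup_fscale [simp]: "Poly_Mapping.lookup (fscale c x) m = c * Poly_Mapping.lookup x m"
  by (simp add: fscale_def map.rep_eq when_def)

lemma fscale_single [simp]:
  "fscale c (Poly_Mapping.single m d) = Poly_Mapping.single m (c * d)"
  by (rule poly_mapping_eqI) (simp add: lookup_single when_def)

interpretation fscale: vector_space fscale
  by unfold_locales (auto intro!: poly_mapping_eqI simp: lookup_add algebra_simps)


section \<open>The Lie algebra \<open>\<gg>'\<close>\<close>

definition L_gen :: "int \<Rightarrow> (int \<Rightarrow>\<^sub>0 complex)" where
  "L_gen m = Poly_Mapping.single m 1"

text \<open>\<open>[L\<^sub>m, L\<^sub>n] = gap_coeff p m n \<cdot> L\<^sub>m\<^sub>+\<^sub>n\<close>; the third case is forced by antisymmetry.\<close>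

definition gap_coeff :: "int \<Rightarrow> int \<Rightarrow> int \<Rightarrow> int" where
  "gap_coeff p m n =
     (if p dvd m \<and> p dvd n then n - m
      else if p dvd m then n
      else if p dvd n then - m
      else 0)"

definition gap_bracket ::
    "int \<Rightarrow> (int \<Rightarrow>\<^sub>0 complex) \<Rightarrow> (int \<Rightarrow>\<^sub>0 complex) \<Rightarrow> (int \<Rightarrow>\<^sub>0 complex)" where
  "gap_bracket p x y =
     (\<Sum>m\<in>Poly_Mapping.keys x. \<Sum>n\<in>Poly_Mapping.keys y.
        fscale (Poly_Mapping.lookup x m * Poly_Mapping.lookup y n * of_int (gap_coeff p m n))
          (L_gen (m + n)))"

lemma gap_bracket_superset:
  assumes "finite A" "finite B" "Poly_Mapping.keys x \<subseteq> A" "Poly_Mapping.keys y \<subseteq> B"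
  shows "gap_bracket p x y =
     (\<Sum>m\<in>A. \<Sum>n\<in>B.
        fscale (Poly_Mapping.lookup x m * Poly_Mapping.lookup y n * of_int (gap_coeff p m n))
          (L_gen (m + n)))"
proof -
  have "gap_bracket p x y = (\<Sum>m\<in>Poly_Mapping.keys x. \<Sum>n\<in>B.
      fscale (Poly_Mapping.lookup x m * Poly_Mapping.lookup y n * of_int (gap_coeff p m n))
        (L_gen (m + n)))"
    unfolding gap_bracket_def
    by (intro sum.cong refl sum.mono_neutral_left assms) (auto simp: in_keys_iff)
  also have "\<dots> = (\<Sum>m\<in>A. \<Sum>n\<in>B.
      fscale (Poly_Mapping.lookup x m * Poly_Mapping.lookup y n * of_int (gap_coeff p m n))
        (L_gen (m + n)))"
    by (intro sum.mono_neutral_left assms) (auto simp: in_keys_iff)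
  finally show ?thesis .
qed

lemma gap_bracket_single:
  "gap_bracket p (Poly_Mapping.single m c) (Poly_Mapping.single n d) =
     Poly_Mapping.single (m + n) (c * d * of_int (gap_coeff p m n))"
  by (subst gap_bracket_superset[of "{m}" "{n}"]) (auto simp: L_gen_def)

lemma gap_bracket_basis:
  assumes "p dvd m" "p dvd n" "\<not> p dvd r" "\<not> p dvd s"
  shows "gap_bracket p (L_gen m) (L_gen n) = fscale (of_int (n - m)) (L_gen (m + n))"
    and "gap_bracket p (L_gen m) (L_gen r) = fscale (of_int r) (L_gen (m + r))"
    and "gap_bracket p (L_gen r) (L_gen s) = 0"
  using assms by (simp_all add: L_gen_def gap_bracket_single gap_coeff_def)

lemma gap_bracket_add_left: "gap_bracket p (x + y) z = gap_bracket p x z + gap_bracket p y z"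
  by (subst (1 2 3) gap_bracket_superset[of
        "Poly_Mapping.keys x \<union> Poly_Mapping.keys y" "Poly_Mapping.keys z"])
     (use keys_add[of x y] in \<open>auto simp: lookup_add fscale.scale_left_distrib
        distrib_right sum.distrib\<close>)

lemma gap_bracket_scale_left: "gap_bracket p (fscale c x) z = fscale c (gap_bracket p x z)"
  by (subst (1 2) gap_bracket_superset[of "Poly_Mapping.keys x" "Poly_Mapping.keys z"])
     (auto simp: in_keys_iff fscale.scale_sum_right mult.assoc)

lemma gap_coeff_swap: "gap_coeff p n m = - gap_coeff p m n"
  by (auto simp: gap_coeff_def)

lemma gap_bracket_swap: "gap_bracket p y x = - gap_bracket p x y"
proof -
  have "gap_bracket p y x =
     (\<Sum>m\<in>Poly_Mapping.keys x. \<Sum>n\<in>Poly_Mapping.keys y.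
        fscale (Poly_Mapping.lookup y n * Poly_Mapping.lookup x m * of_int (gap_coeff p n m))
          (L_gen (n + m)))"
    unfolding gap_bracket_def by (rule sum.swap)
  also have "\<dots> = (\<Sum>m\<in>Poly_Mapping.keys x. \<Sum>n\<in>Poly_Mapping.keys y.
        - fscale (Poly_Mapping.lookup x m * Poly_Mapping.lookup y n * of_int (gap_coeff p m n))
          (L_gen (m + n)))"
    by (intro sum.cong refl)
       (subst gap_coeff_swap, simp add: mult.commute add.commute)
  finally show ?thesis by (simp add: gap_bracket_def sum_negf)
qed

lemma gap_bracket_add_right: "gap_bracket p z (x + y) = gap_bracket p z x + gap_bracket p z y"
  unfolding gap_bracket_swap[of p z] by (simp add: gap_bracket_add_left)

lemma gap_bracket_scale_right: "gap_bracket p z (fscale c x) = fscale c (gap_bracket p z x)"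
  unfolding gap_bracket_swap[of p z] by (simp add: gap_bracket_scale_left)

lemma gap_bracket_zero [simp]: "gap_bracket p 0 x = 0" "gap_bracket p x 0 = 0"
  by (simp_all add: gap_bracket_def)

lemma single_add_induct:
  fixes x :: "int \<Rightarrow>\<^sub>0 complex"
  assumes "P 0" "\<And>m c. P (Poly_Mapping.single m c)" "\<And>x y. P x \<Longrightarrow> P y \<Longrightarrow> P (x + y)"
  shows "P x"
proof (induction x rule: update_induct)
  case (update f a b)
  have "Poly_Mapping.update a b f = f + Poly_Mapping.single a b"
    using update.hyps(1)
    by (intro poly_mapping_eqI)
       (auto simp: lookup_update lookup_add lookup_single when_def in_keys_iff)
  then show ?case using update assms by simp
qed (rule assms)

lemma gap_coeff_jacobi:
  "gap_coeff p n k * gap_coeff p m (n + k) + gap_coeff p k m * gap_coeff p n (k + m)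
     + gap_coeff p m n * gap_coeff p k (m + n) = 0"
proof -
  have dvd: "p dvd a \<Longrightarrow> p dvd (a + b) \<longleftrightarrow> p dvd b" "p dvd b \<Longrightarrow> p dvd (a + b) \<longleftrightarrow> p dvd a"
    for a b
    by (simp_all add: dvd_add_right_iff dvd_add_left_iff)
  show ?thesis
    unfolding gap_coeff_def
    by (cases "p dvd m"; cases "p dvd n"; cases "p dvd k") (simp_all add: dvd, simp_all add: algebra_simps)
qed

lemma gap_bracket_jacobi:
  "gap_bracket p x (gap_bracket p y z) + gap_bracket p y (gap_bracket p z x)
     + gap_bracket p z (gap_bracket p x y) = 0" (is "?J x y z = 0")
proof -
  have 1: "?J (Poly_Mapping.single m a) (Poly_Mapping.single n b) (Poly_Mapping.single k c) = 0"
    for m n k a b c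
  proof -
    have "?J (Poly_Mapping.single m a) (Poly_Mapping.single n b) (Poly_Mapping.single k c) =
        Poly_Mapping.single (m + n + k) (a * b * c * of_int
          (gap_coeff p n k * gap_coeff p m (n + k) + gap_coeff p k m * gap_coeff p n (k + m)
             + gap_coeff p m n * gap_coeff p k (m + n)))"
      by (rule poly_mapping_eqI)
         (simp add: gap_bracket_single lookup_add lookup_single when_def algebra_simps)
    then show ?thesis by (simp only: gap_coeff_jacobi) simp
  qed
  have 2: "?J (Poly_Mapping.single m a) (Poly_Mapping.single n b) z = 0" for m n a b z
  proof (induction z rule: single_add_induct)
    case (3 u v)
    have "?J (Poly_Mapping.single m a) (Poly_Mapping.single n b) (u + v) =
        ?J (Poly_Mapping.single m a) (Poly_Mapping.single n b) u
        + ?J (Poly_Mapping.single m a) (Poly_Mapping.single n b) v"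
      by (simp only: gap_bracket_add_left gap_bracket_add_right ac_simps)
    then show ?case by (simp only: 3 add_0)
  qed (simp_all add: 1)
  have 3: "?J (Poly_Mapping.single m a) y z = 0" for m a y z
  proof (induction y rule: single_add_induct)
    case (3 u v)
    have "?J (Poly_Mapping.single m a) (u + v) z =
        ?J (Poly_Mapping.single m a) u z + ?J (Poly_Mapping.single m a) v z"
      by (simp only: gap_bracket_add_left gap_bracket_add_right ac_simps)
    then show ?case by (simp only: 3 add_0)
  qed (simp_all add: 2)
  show ?thesis
  proof (induction x rule: single_add_induct)
    case (3 u v)
    have "?J (u + v) y z =
        ?J u y z + ?J v y z"
      by (simp only: gap_bracket_add_left gap_bracket_add_right ac_simps)
    then show ?case by (simp only: 3 add_0)
  qed (simp_all add: 3)
qed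

lemma lie_algebra_gap: "lie_algebra fscale (gap_bracket p)"
proof unfold_locales
  show "gap_bracket p x x = 0" for x
  proof (rule poly_mapping_eqI)
    fix i
    have "Poly_Mapping.lookup (gap_bracket p x x) i = - Poly_Mapping.lookup (gap_bracket p x x) i"
      by (subst gap_bracket_swap) (rule lookup_uminus)
    then show "Poly_Mapping.lookup (gap_bracket p x x) i = Poly_Mapping.lookup 0 i"
      unfolding complex_eq_iff uminus_complex.sel lookup_zero zero_complex.sel equal_neg_zero .
  qed
qed (simp_all add: gap_bracket_add_left gap_bracket_add_right gap_bracket_scale_left
      gap_bracket_scale_right gap_bracket_jacobi)


section \<open>The associative algebra \<open>\<A>\<close>\<close>

text \<open>Addition, multiplication (convolution) and unit are those of \<open>int \<Rightarrow>\<^sub>0 complex\<close>.\<close>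

definition laurent :: "int \<Rightarrow> (int \<Rightarrow>\<^sub>0 complex) set" where
  "laurent p = {a. Poly_Mapping.keys a \<subseteq> {m. p dvd m}}"

definition t_pow :: "int \<Rightarrow> (int \<Rightarrow>\<^sub>0 complex)" where
  "t_pow m = Poly_Mapping.single m 1"

lemma t_pow_mult: "t_pow m * t_pow n = t_pow (m + n)" and t_pow_zero: "t_pow 0 = 1"
  by (simp_all add: t_pow_def mult_single)

lemma laurent_eq_span: "laurent p = fscale.span (t_pow ` {m. p dvd m})"
proof
  show "fscale.span (t_pow ` {m. p dvd m}) \<subseteq> laurent p"
  proof (rule fscale.span_minimal)
    show "fscale.subspace (laurent p)"
      unfolding fscale.subspace_def laurent_def
      by (auto simp: in_keys_iff subset_iff lookup_add) (metis add_0)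
  qed (auto simp: laurent_def t_pow_def)
next
  show "laurent p \<subseteq> fscale.span (t_pow ` {m. p dvd m})"
  proof
    fix a assume a: "a \<in> laurent p"
    have "a = (\<Sum>m\<in>Poly_Mapping.keys a. fscale (Poly_Mapping.lookup a m) (t_pow m))"
      by (rule poly_mapping_eqI)
         (simp add: lookup_sum t_pow_def lookup_single when_def in_keys_iff)
    also have "\<dots> \<in> fscale.span (t_pow ` {m. p dvd m})"
      using a by (intro fscale.span_sum fscale.span_scale fscale.span_base)
        (auto simp: laurent_def)
    finally show "a \<in> fscale.span (t_pow ` {m. p dvd m})" .
  qed
qed


section \<open>\<open>\<A>\<gg>'\<close>-modules\<close>

text \<open>
  \<open>act\<close> is the action of \<open>\<gg>'\<close> and \<open>tact\<close> the action of \<open>\<A>\<close>; the values of \<open>tact\<close>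
  outside \<open>laurent p\<close> are irrelevant.
\<close>

locale Ag_module = lie_module fscale "gap_bracket p" scale act
  for p :: int
    and scale :: "complex \<Rightarrow> 'v::ab_group_add \<Rightarrow> 'v"
    and act :: "(int \<Rightarrow>\<^sub>0 complex) \<Rightarrow> 'v \<Rightarrow> 'v" +
  fixes tact :: "(int \<Rightarrow>\<^sub>0 complex) \<Rightarrow> 'v \<Rightarrow> 'v"
  assumes tact_linear: "a \<in> laurent p \<Longrightarrow> Vector_Spaces.linear scale scale (tact a)"
    and tact_add: "a \<in> laurent p \<Longrightarrow> b \<in> laurent p \<Longrightarrow> tact (a + b) v = tact a v + tact b v"
    and tact_scale: "a \<in> laurent p \<Longrightarrow> tact (fscale c a) v = scale c (tact a v)"
    and tact_mult: "a \<in> laurent p \<Longrightarrow> b \<in> laurent p \<Longrightarrow> tact (a * b) v = tact a (tact b v)"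
    and tact_one: "tact 1 v = v"
    and act_tact: "p dvd m \<Longrightarrow> p dvd n \<Longrightarrow>
      act (L_gen m) (tact (t_pow n) v) - tact (t_pow n) (act (L_gen m) v) = scale (of_int n) (tact (t_pow (m + n)) v)"
    and tact_act: "p dvd n \<Longrightarrow> \<not> p dvd r \<Longrightarrow>
      tact (t_pow n) (act (L_gen r) v) = act (L_gen r) (tact (t_pow n) v)"
begin

definition Ag_submodule :: "'v set \<Rightarrow> bool" where
  "Ag_submodule W \<longleftrightarrow> V.subspace W \<and> (\<forall>x. \<forall>w\<in>W. act x w \<in> W)
     \<and> (\<forall>a\<in>laurent p. \<forall>w\<in>W. tact a w \<in> W)"

definition irreducible_module :: bool where
  "irreducible_module \<longleftrightarrow> (\<exists>v::'v. v \<noteq> 0) \<and> (\<forall>W. Ag_submodule W \<longrightarrow> W = {0} \<or> W = UNIV)"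

definition weight_space :: "complex \<Rightarrow> 'v set" where
  "weight_space \<mu> = {v. act (L_gen 0) v = scale \<mu> v}"

definition L0_diagonalizable :: bool where
  "L0_diagonalizable \<longleftrightarrow>
     (\<exists>B. V.independent B \<and> V.span B = UNIV \<and> (\<forall>b\<in>B. \<exists>\<mu>. b \<in> weight_space \<mu>))"

text \<open>\<open>V.dim\<close> alone does not express finiteness: it is \<open>0\<close> on infinite-dimensional spaces.\<close>

definition finite_dim :: "'v set \<Rightarrow> bool" where
  "finite_dim W \<longleftrightarrow> (\<exists>B. finite B \<and> W \<subseteq> V.span B)"

definition cuspidal :: bool where
  "cuspidal \<longleftrightarrow> L0_diagonalizable
     \<and> (\<exists>k>0. \<forall>\<mu>. finite_dim (weight_space \<mu>) \<and> V.dim (weight_space \<mu>) < k)"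

definition intermediate_series :: bool where
  "intermediate_series \<longleftrightarrow> (\<forall>\<mu>. finite_dim (weight_space \<mu>) \<and> V.dim (weight_space \<mu>) \<le> 1)"

end

end

theory Submission
  imports Defs "HOL-Computational_Algebra.Fundamental_Theorem_Algebra"
begin

text \<open>
  Write \<open>L\<^sub>m = t\<^sup>m (L\<^sub>0 + E\<^sub>m)\<close> for \<open>m \<in> p\<int>\<close>. The operators \<open>E\<^sub>m\<close> and \<open>t\<^sup>-\<^sup>m L\<^sub>m\<^sub>+\<^sub>r\<close> commute with
  \<open>\<A>\<close>, and the \<open>E\<^sub>m\<close> span a copy of the vector fields \<open>(t\<^sup>m - 1) t \<partial>\<^sub>t\<close> vanishing at \<open>t\<^sup>p = 1\<close>. Since
  there are only finitely many weights modulo \<open>p\<close>, every linear operator commuting with \<open>\<A>\<close> and \<open>L\<^sub>0\<close>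
  satisfies a polynomial equation. A vector belonging to an eigenvalue of \<open>- E\<^sub>-\<^sub>p\<close> of maximal real
  part turns out to be killed by all operators \<open>n E\<^sub>m - m E\<^sub>n\<close> and \<open>L\<^sub>m\<^sub>+\<^sub>r - t\<^sup>m L\<^sub>r\<close>. The common kernel of
  these is a submodule, hence everything. Now all \<open>E\<^sub>m\<close>, \<open>L\<^sub>r\<close> and \<open>t\<^sup>m\<close> commute, so by Schur's lemma the
  \<open>E\<^sub>m\<close> and the monomials of weight \<open>0\<close> in the \<open>L\<^sub>r\<close> and \<open>t\<^sup>m\<close> are scalars, and a single weight vector
  spans its weight space.
\<close>

section \<open>Operators annihilated by a polynomial\<close>

locale complex_vector_space = vector_space scale
  for scale :: "complex \<Rightarrow> 'v::ab_group_add \<Rightarrow> 'v"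
begin

abbreviation lin :: "('v \<Rightarrow> 'v) \<Rightarrow> bool" where
  "lin \<equiv> Vector_Spaces.linear scale scale"

lemma linI:
  assumes "\<And>x y. f (x + y) = f x + f y" "\<And>c x. f (scale c x) = scale c (f x)"
  shows "lin f"
  using assms by unfold_locales auto

lemma lin_simps:
  assumes "lin f"
  shows "f (x + y) = f x + f y" "f (x - y) = f x - f y" "f (- x) = - f x" "f 0 = 0"
    "f (scale c x) = scale c (f x)"
proof -
  interpret f: Vector_Spaces.linear scale scale f by (fact assms)
  show "f (x + y) = f x + f y" "f (x - y) = f x - f y" "f (- x) = - f x" "f 0 = 0"
    "f (scale c x) = scale c (f x)"
    by (rule f.add f.diff f.neg f.zero f.scale)+
qed

text \<open>The list holds the roots, with multiplicity, of a monic polynomial evaluated at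
  \<open>f\<close> and applied to \<open>w\<close>. Over the complex numbers every nonzero
  polynomial splits like this up to a scalar.\<close>

primrec shift_prod :: "('v \<Rightarrow> 'v) \<Rightarrow> complex list \<Rightarrow> 'v \<Rightarrow> 'v" where
  "shift_prod f [] w = w"
| "shift_prod f (a # as) w = shift_prod f as (f w - scale a w)"

definition algebraic :: "('v \<Rightarrow> 'v) \<Rightarrow> bool" where
  "algebraic f \<longleftrightarrow> (\<exists>as. \<forall>w. shift_prod f as w = 0)"

lemma lin_shift_prod: "lin f \<Longrightarrow> lin (shift_prod f as)"
proof (induction as)
  case Nil
  then show ?case by (intro linI) auto
next
  case (Cons a as)
  then show ?case
    by (intro linI) (simp_all add: lin_simps scale_right_distrib scale_right_diff_distrib mult.commute)
qed

lemma shift_prod_append: "shift_prod f (as @ bs) w = shift_prod f bs (shift_prod f as w)"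
  by (induction as arbitrary: w) auto

text \<open>\<open>X\<close> raises eigenvalues of \<open>f\<close> by \<open>b\<close>, so all
  roots move by \<open>b\<close> when the product is pulled through \<open>X\<close>.\<close>

lemma shift_prod_shift:
  assumes "lin X" "\<And>w. f (X w) = X (f w) + scale b (X w)"
  shows "shift_prod f (map (\<lambda>a. a + b) as) (X w) = X (shift_prod f as w)"
proof (induction as arbitrary: w)
  case (Cons a as)
  have "f (X w) - scale (a + b) (X w) = X (f w - scale a w)"
    by (simp add: assms(2) lin_simps[OF assms(1)] scale_left_distrib)
  then show ?case by (simp add: Cons)
qed simp

lemma shift_prod_commute:
  assumes "lin X" "\<And>w. f (X w) = X (f w)"
  shows "shift_prod f as (X w) = X (shift_prod f as w)"
  using shift_prod_shift[of X f 0 as w] assms by simp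

lemma shift_prod_swap:
  assumes "lin f"
  shows "shift_prod f as (shift_prod f bs w) = shift_prod f bs (shift_prod f as w)"
proof (rule shift_prod_commute)
  show "f (shift_prod f bs v) = shift_prod f bs (f v)" for v
    by (rule shift_prod_commute[symmetric]) (simp_all add: assms)
qed (rule lin_shift_prod[OF assms])

lemma shift_prod_eigenvector:
  assumes "lin f" "f z = scale \<mu> z"
  shows "shift_prod f as z = scale (\<Prod>a\<leftarrow>as. \<mu> - a) z"
proof (induction as)
  case (Cons a as)
  have "shift_prod f (a # as) z = shift_prod f as (scale (\<mu> - a) z)"
    by (simp add: assms scale_left_diff_distrib)
  then show ?case
    by (simp add: Cons lin_simps[OF lin_shift_prod[OF assms(1)]])
qed simp

lemma shift_prod_injective:
  assumes "\<And>a u. a \<in> set as \<Longrightarrow> f u = scale a u \<Longrightarrow> u = 0" "shift_prod f as w = 0"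
  shows "w = 0"
  using assms
proof (induction as arbitrary: w)
  case (Cons a as)
  have "f w - scale a w = 0" by (rule Cons.IH) (use Cons.prems in auto)
  then show ?case using Cons.prems(1)[of a w] by simp
qed simp

text \<open>All eigenvalues lie among the roots of an annihilating list, so there are finitely many.
  Without any, every factor would be injective and the product could not kill
  \<open>w\<close>.\<close>

lemma algebraic_extremal_eigenvector:
  fixes w :: 'v
  assumes f: "lin f" "algebraic f" and w: "w \<noteq> 0"
  obtains v c where "v \<noteq> 0" "f v = scale c v"
    "\<And>u a. f u = scale a u \<Longrightarrow> u \<noteq> 0 \<Longrightarrow> Re a \<le> Re c"
proof -
  obtain as where as: "\<And>w. shift_prod f as w = 0" using f(2) unfolding algebraic_def by blast
  define S where "S = {a. \<exists>u. u \<noteq> 0 \<and> f u = scale a u}"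
  have "S \<subseteq> set as"
  proof
    fix a assume "a \<in> S"
    then obtain u where u: "u \<noteq> 0" "f u = scale a u" by (auto simp: S_def)
    have "scale (\<Prod>b\<leftarrow>as. a - b) u = 0"
      using shift_prod_eigenvector[OF f(1) u(2), of as] as by simp
    then have "0 \<in> set (map (\<lambda>b. a - b) as)" using u(1) by (simp add: prod_list_zero_iff)
    then show "a \<in> set as" by auto
  qed
  then have fin: "finite (Re ` S)" by (meson finite_imageI finite_set finite_subset)
  have "S \<noteq> {}"
  proof
    assume "S = {}"
    then have "w = 0" by (intro shift_prod_injective[OF _ as[of w]]) (auto simp: S_def)
    then show False using w by simp
  qed
  then have "Max (Re ` S) \<in> Re ` S" using fin by (intro Max_in) auto
  then obtain c where c: "c \<in> S" "Re c = Max (Re ` S)" by force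
  then obtain v where "v \<noteq> 0" "f v = scale c v" by (auto simp: S_def)
  moreover have "Re a \<le> Re c" if "f u = scale a u" "u \<noteq> 0" for u a
    unfolding c(2) using that fin by (intro Max_ge imageI) (auto simp: S_def)
  ultimately show ?thesis using that by blast
qed

section \<open>Annihilating polynomials from finite dimension\<close>

text \<open>A root \<open>a\<close> of \<open>q\<close> splits off a linear factor, and the relation
  for \<open>q\<close> at \<open>w\<close> becomes one for the quotient at
  \<open>f w - scale a w\<close>.\<close>

lemma shift_prod_of_relation:
  assumes f: "lin f" and "q \<noteq> 0" "(\<Sum>i\<le>degree q. scale (coeff q i) ((f ^^ i) w)) = 0"
  shows "\<exists>as. shift_prod f as w = 0"
  using assms(2,3)
proof (induction "degree q" arbitrary: q w)
  case 0
  then have "coeff q 0 \<noteq> 0" by (metis leading_coeff_neq_0)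
  then have "w = 0" using 0 by simp
  then show ?case by (intro exI[of _ "[]"]) simp
next
  case (Suc n)
  then have "\<not> constant (poly q)" by (simp add: constant_degree)
  then obtain a where "poly q a = 0" using fundamental_theorem_of_algebra by blast
  then obtain q' where q: "q = [:- a, 1:] * q'" by (auto simp: poly_eq_0_iff_dvd)
  with Suc.prems have q': "q' \<noteq> 0" by auto
  then have deg: "degree q = Suc (degree q')"
    unfolding q by (subst degree_mult_eq) auto
  have pow: "(f ^^ i) (u - scale a v) = (f ^^ i) u - scale a ((f ^^ i) v)" for i u v
    by (induction i) (simp_all add: lin_simps[OF f])
  let ?N = "degree q'"
  have c: "coeff q i = (case i of 0 \<Rightarrow> 0 | Suc j \<Rightarrow> coeff q' j) - a * coeff q' i" for i
    unfolding q by (simp add: coeff_pCons)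
  have "(\<Sum>i\<le>degree q. scale (coeff q i) ((f ^^ i) w)) =
      (\<Sum>i\<le>Suc ?N. scale (case i of 0 \<Rightarrow> 0 | Suc j \<Rightarrow> coeff q' j) ((f ^^ i) w))
      - (\<Sum>i\<le>Suc ?N. scale (a * coeff q' i) ((f ^^ i) w))"
    by (simp only: c deg scale_left_diff_distrib sum_subtractf)
  also have "(\<Sum>i\<le>Suc ?N. scale (case i of 0 \<Rightarrow> 0 | Suc j \<Rightarrow> coeff q' j) ((f ^^ i) w)) =
      (\<Sum>i\<le>?N. scale (coeff q' i) ((f ^^ i) (f w)))"
    by (simp only: sum.atMost_Suc_shift) (simp add: funpow_swap1)
  also have "(\<Sum>i\<le>Suc ?N. scale (a * coeff q' i) ((f ^^ i) w)) =
      (\<Sum>i\<le>?N. scale (a * coeff q' i) ((f ^^ i) w))"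
    by (simp add: coeff_eq_0)
  also have "(\<Sum>i\<le>?N. scale (coeff q' i) ((f ^^ i) (f w)))
      - (\<Sum>i\<le>?N. scale (a * coeff q' i) ((f ^^ i) w)) =
      (\<Sum>i\<le>?N. scale (coeff q' i) ((f ^^ i) (f w - scale a w)))"
    by (simp add: pow sum_subtractf[symmetric] scale_right_diff_distrib mult.commute)
  finally obtain as where "shift_prod f as (f w - scale a w) = 0"
    using Suc.hyps(1)[of q' "f w - scale a w"] Suc.hyps(2) Suc.prems(2) q' deg by auto
  then show ?case by (intro exI[of _ "a # as"]) simp
qed

lemma shift_prod_of_finite_span:
  assumes f: "lin f" and B: "finite B" and S: "\<And>i. (f ^^ i) w \<in> span B"
  shows "\<exists>as. shift_prod f as w = 0"
proof -
  let ?n = "card B" and ?g = "\<lambda>i. (f ^^ i) w"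
  obtain c :: "nat \<Rightarrow> complex" and k where k: "k \<le> ?n" "c k \<noteq> 0" and c: "(\<Sum>i\<le>?n. scale (c i) (?g i)) = 0"
  \<comment> \<open>\<open>dependent\<close> speaks of sets, so two equal iterates need a relation
    of their own.\<close>
  proof (cases "inj_on ?g {..?n}")
    case False
    then obtain i j where ij: "i \<le> ?n" "j \<le> ?n" "i \<noteq> j" "?g i = ?g j" by (auto simp: inj_on_def)
    let ?c = "\<lambda>l. (if l = i then 1 else 0) - (if l = j then 1 else 0)"
    have "(\<Sum>l\<le>?n. scale (?c l) (?g l)) =
       (\<Sum>l\<le>?n. (if l = i then ?g l else 0)) - (\<Sum>l\<le>?n. (if l = j then ?g l else 0))"
      unfolding sum_subtractf[symmetric] by (intro sum.cong) auto
    also have "\<dots> = 0" using ij by simp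
    finally show ?thesis using ij that[of i ?c] by simp
  next
    case True
    then have card: "card (?g ` {..?n}) = Suc ?n" by (simp add: card_image)
    have "dependent (?g ` {..?n})"
      using independent_span_bound[OF B, of "?g ` {..?n}"] S card by auto
    then obtain u k where "k \<le> ?n" "u (?g k) \<noteq> 0" "(\<Sum>v\<in>?g ` {..?n}. scale (u v) v) = 0"
      by (auto simp: dependent_finite)
    then show ?thesis using that[of k "\<lambda>i. u (?g i)"] True by (simp add: sum.reindex)
  qed
  define q where "q = (\<Sum>i\<le>?n. monom (c i) i)"
  have coeff: "coeff q i = (if i \<le> ?n then c i else 0)" for i
    by (simp add: q_def coeff_sum)
  have "q \<noteq> 0" using k coeff[of k] by auto
  moreover have "(\<Sum>i\<le>degree q. scale (coeff q i) (?g i)) = (\<Sum>i\<le>?n. scale (coeff q i) (?g i))"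
  proof (rule sum.mono_neutral_left)
    show "{..degree q} \<subseteq> {..?n}" by (auto intro!: degree_le simp: coeff)
  qed (auto simp: not_le coeff_eq_0)
  ultimately show ?thesis
    using c by (intro shift_prod_of_relation[OF f, of q]) (auto simp: coeff[abs_def])
qed

text \<open>The lists are concatenated. The factors commute, so each \<open>U i\<close> can meet its
  own list first.\<close>

lemma shift_prod_common:
  assumes f: "lin f" and "finite I" "\<And>i. i \<in> I \<Longrightarrow> \<exists>as. \<forall>u\<in>U i. shift_prod f as u = 0"
  shows "\<exists>as. \<forall>i\<in>I. \<forall>u\<in>U i. shift_prod f as u = 0"
  using assms(2,3)
proof (induction I)
  case (insert i I)
  obtain as where as: "\<forall>i\<in>I. \<forall>u\<in>U i. shift_prod f as u = 0"
    using insert.IH insert.prems by (meson insertCI)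
  obtain bs where bs: "\<forall>u\<in>U i. shift_prod f bs u = 0"
    using insert.prems[of i] by auto
  have z: "shift_prod f cs 0 = 0" for cs by (simp add: lin_simps[OF lin_shift_prod[OF f]])
  have "shift_prod f (bs @ as) u = 0" if "j \<in> I" "u \<in> U j" for j u
    unfolding shift_prod_append shift_prod_swap[OF f, of as bs] using as that by (simp add: z)
  moreover have "shift_prod f (bs @ as) u = 0" if "u \<in> U i" for u
    using bs that by (simp add: shift_prod_append z)
  ultimately have "\<forall>j\<in>insert i I. \<forall>u\<in>U j. shift_prod f (bs @ as) u = 0" by blast
  then show ?case by blast
qed auto

lemma shift_prod_of_finite_dim:
  assumes f: "lin f" "f ` S \<subseteq> S" and B: "finite B" "S \<subseteq> span B"
  shows "\<exists>as. \<forall>w\<in>S. shift_prod f as w = 0"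
proof -
  obtain C where C: "C \<subseteq> S" "independent C" "S \<subseteq> span C" by (rule basis_exists)
  have "finite C" using independent_span_bound[OF B(1) C(2) subset_trans[OF C(1) B(2)]] ..
  moreover have "\<exists>as. \<forall>u\<in>{b}. shift_prod f as u = 0" if "b \<in> C" for b
  proof -
    have "(f ^^ i) b \<in> span B" for i
    proof -
      have "(f ^^ i) b \<in> S"
      proof (induction i)
        case 0
        show ?case using subsetD[OF C(1) that] by simp
      next
        case (Suc i)
        then have "f ((f ^^ i) b) \<in> S" using f(2) by (rule subsetD[rotated, OF imageI])
        then show ?case by simp
      qed
      then show ?thesis by (rule subsetD[OF B(2)])
    qed
    then have "\<exists>as. shift_prod f as b = 0" by (rule shift_prod_of_finite_span[OF f(1) B(1)])
    then show ?thesis by simp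
  qed
  ultimately have "\<exists>as. \<forall>b\<in>C. \<forall>u\<in>{b}. shift_prod f as u = 0"
    by (rule shift_prod_common[OF f(1)])
  then obtain as where as: "\<And>b. b \<in> C \<Longrightarrow> shift_prod f as b = 0" by auto
  have "shift_prod f as w = 0" if "w \<in> span C" for w
    using that
  proof (induction rule: span_induct_alt)
    case base
    show ?case by (simp add: lin_simps(4)[OF lin_shift_prod[OF f(1)]])
  next
    case (step c x y)
    then show ?case by (simp add: as lin_simps(1,5)[OF lin_shift_prod[OF f(1)]])
  qed
  then have "\<forall>w\<in>S. shift_prod f as w = 0" using subsetD[OF C(3)] by simp
  then show ?thesis ..
qed

lemma span_stable:
  assumes f: "lin f" "\<And>u. u \<in> S \<Longrightarrow> f u \<in> span S" and w: "w \<in> span S"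
  shows "f w \<in> span S"
  using w
proof (induction rule: span_induct_alt)
  case base
  show ?case by (simp add: lin_simps[OF f(1)] span_zero)
next
  case (step c x y)
  then show ?case by (simp add: lin_simps[OF f(1)] span_add span_scale f(2))
qed

section \<open>Vector fields vanishing at a point\<close>

text \<open>These bring \<open>scale 2 v\<close> and \<open>v + v\<close> to a common form, so that
  the simplifier can cancel them.\<close>

lemma scale_double: "scale 2 v = v + v" "scale (a * 2) v = scale a v + scale a v"
    "scale (a * (b * 2)) v = scale (a * b) v + scale (a * b) v"
  using scale_left_distrib[of 1 1 v] by (simp_all flip: scale_left_distrib)

text \<open>The deviation \<open>u\<close> of \<open>e (n + 1) v\<close> from the expected multiple
  of \<open>v\<close> satisfies the eigenvalue equation of \<open>e (- 1)\<close> for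
  \<open>- (c + n + 1)\<close>, so \<open>top\<close> forces it to vanish.\<close>

lemma quasi_witt_half_eigenvector:
  fixes e :: "int \<Rightarrow> 'v \<Rightarrow> 'v"
  assumes lin: "\<And>j. lin (e j)"
    and rel: "\<And>i j v. e i (e j v) - e j (e i v) =
        scale (of_int (j - i)) (e (i + j) v) - scale (of_int j) (e j v) + scale (of_int i) (e i v)"
    and e0: "\<And>v. e 0 v = 0"
    and v: "e (- 1) v = scale (- c) v"
    and top: "\<And>u n. n \<ge> (1::nat) \<Longrightarrow> e (- 1) u = scale (- (c + of_nat n)) u \<Longrightarrow> u = 0"
  shows "e (int n) v = scale (of_nat n * c) v"
proof (induction n)
  case 0
  show ?case by (simp add: e0)
next
  case (Suc n)
  let ?j = "int (Suc n)"
  define u where "u = e ?j v - scale (of_nat (Suc n) * c) v"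
  have "e (- 1) (e ?j v) = e ?j (e (- 1) v) + scale (of_nat n + 2) (e (int n) v)
      - scale (of_nat n + 1) (e ?j v) - e (- 1) v"
    using rel[of "- 1" ?j v] by (simp add: algebra_simps)
  then have "e (- 1) u = scale (- (c + of_nat (Suc n))) u"
    unfolding u_def Suc v by (simp add: lin_simps[OF lin] v) (simp add: algebra_simps scale_double)
  then have "u = 0" by (intro top[of "Suc n"]) auto
  then show ?case by (simp add: u_def)
qed

text \<open>The reflected family \<open>e'\<close> satisfies the same relations, with
  \<open>e 1\<close> in the role of \<open>- e (- 1)\<close>. Hence the half-line lemma applies in
  both directions, once the maximal eigenvalues \<open>c\<close> of \<open>- e (- 1)\<close> and
  \<open>c'\<close> of \<open>e 1\<close> have been compared.\<close>

lemma quasi_witt_eigenvector: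
  fixes e :: "int \<Rightarrow> 'v \<Rightarrow> 'v" and w :: 'v
  assumes lin: "\<And>j. lin (e j)"
    and rel: "\<And>i j v. e i (e j v) - e j (e i v) =
        scale (of_int (j - i)) (e (i + j) v) - scale (of_int j) (e j v) + scale (of_int i) (e i v)"
    and e0: "\<And>v. e 0 v = 0"
    and alg: "algebraic (e 1)" "algebraic (\<lambda>v. - e (- 1) v)" and w: "w \<noteq> 0"
  obtains v c where "v \<noteq> 0" "\<And>j. e j v = scale (of_int j * c) v"
    "\<And>u a. - e (- 1) u = scale a u \<Longrightarrow> u \<noteq> 0 \<Longrightarrow> Re a \<le> Re c"
proof -
  define e' where "e' j v = - e (- j) v" for j v
  have lin': "lin (e' j)" for j
    unfolding e'_def by (rule linI) (simp_all add: lin_simps[OF lin])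
  have rel': "e' i (e' j v) - e' j (e' i v) =
      scale (of_int (j - i)) (e' (i + j) v) - scale (of_int j) (e' j v) + scale (of_int i) (e' i v)" for i j v
    using rel[of "- i" "- j" v] by (simp add: e'_def lin_simps[OF lin] algebra_simps)
  obtain v c where v: "v \<noteq> 0" "- e (- 1) v = scale c v"
    and c: "\<And>u a. - e (- 1) u = scale a u \<Longrightarrow> u \<noteq> 0 \<Longrightarrow> Re a \<le> Re c"
    using algebraic_extremal_eigenvector[OF lin'[of 1, unfolded e'_def] alg(2) w] by blast
  obtain v' c' where v': "v' \<noteq> 0" "e 1 v' = scale c' v'"
    and c': "\<And>u a. e 1 u = scale a u \<Longrightarrow> u \<noteq> 0 \<Longrightarrow> Re a \<le> Re c'"
    using algebraic_extremal_eigenvector[OF lin alg(1) w] by blast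
  \<comment> \<open>This makes \<open>c'\<close> an eigenvalue of \<open>- e (- 1)\<close>, so its
    real part is at most that of \<open>c\<close>.\<close>
  have "e' (int 1) v' = scale (of_nat 1 * c') v'"
  proof (rule quasi_witt_half_eigenvector[OF lin' rel'])
    show "e' 0 v = 0" for v by (simp add: e'_def e0)
    show "e' (- 1) v' = scale (- c') v'" by (simp add: e'_def v')
    show "u = 0" if "1 \<le> n" "e' (- 1) u = scale (- (c' + of_nat n)) u" for u n
    proof -
      have "e 1 u = scale (c' + of_nat n) u"
        using that(2) by (simp only: e'_def minus_minus scale_minus_left neg_equal_iff_equal)
      then show ?thesis using c'[of u "c' + of_nat n"] that(1) by auto
    qed
  qed
  then have "Re c' \<le> Re c" using c[of v' c'] v'(1) by (simp add: e'_def)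
  have pos: "e (int n) v = scale (of_nat n * c) v" for n
  proof (rule quasi_witt_half_eigenvector[OF lin rel e0])
    show "e (- 1) v = scale (- c) v" using v(2) by (simp add: minus_equation_iff)
    show "u = 0" if "1 \<le> n" "e (- 1) u = scale (- (c + of_nat n)) u" for u n
    proof -
      have "- e (- 1) u = scale (c + of_nat n) u" using that(2) by (metis minus_minus scale_minus_left)
      then show ?thesis using c[of u "c + of_nat n"] that(1) by auto
    qed
  qed
  \<comment> \<open>By \<open>pos\<close> at index 1, \<open>v\<close> is also an eigenvector of
    \<open>e 1\<close> for \<open>c\<close>. As \<open>Re c' \<le> Re c\<close>, no
    \<open>c + n\<close> with \<open>n \<ge> 1\<close> is an eigenvalue of
    \<open>e 1\<close>.\<close>
  have neg: "e' (int n) v = scale (of_nat n * c) v" for n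
  proof (rule quasi_witt_half_eigenvector[OF lin' rel'])
    show "e' 0 v = 0" for v by (simp add: e'_def e0)
    show "e' (- 1) v = scale (- c) v" using pos[of 1] by (simp add: e'_def)
    show "u = 0" if "1 \<le> n" "e' (- 1) u = scale (- (c + of_nat n)) u" for u n
    proof -
      have "e 1 u = scale (c + of_nat n) u"
        using that(2) by (simp only: e'_def minus_minus scale_minus_left neg_equal_iff_equal)
      then show ?thesis using c'[of u "c + of_nat n"] \<open>Re c' \<le> Re c\<close> that(1) by auto
    qed
  qed
  have "e j v = scale (of_int j * c) v" for j
  proof (cases "j \<ge> 0")
    case True
    then show ?thesis using pos[of "nat j"] by simp
  next
    case False
    then have "- e j v = scale (- of_int j * c) v" using neg[of "nat (- j)"] by (simp add: e'_def)
    then show ?thesis by simp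
  qed
  then show ?thesis using v(1) c that by blast
qed

text \<open>In the model where \<open>e j\<close> is \<open>(s\<^sup>j - 1) s \<partial>\<^sub>s\<close> and \<open>y j\<close> is \<open>s\<close> to the power \<open>\<rho> + j\<close>, the operators
  \<open>H = - e (- 1)\<close> and \<open>X = e 1 - H\<close> become \<open>x \<partial>\<^sub>x\<close> and \<open>x\<^sup>2 \<partial>\<^sub>x\<close> for \<open>x = s - 1\<close>. The difference of
  consecutive \<open>y j\<close> would have to be built from \<open>H\<close>-eigenvectors above the extremal eigenvalue \<open>c\<close>.\<close>

lemma tensor_family_constant:
  fixes e :: "int \<Rightarrow> 'v \<Rightarrow> 'v" and y :: "int \<Rightarrow> 'v"
  assumes lin: "\<And>j. lin (e j)"
    and rel: "\<And>i j v. e i (e j v) - e j (e i v) =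
        scale (of_int (j - i)) (e (i + j) v) - scale (of_int j) (e j v) + scale (of_int i) (e i v)"
    and e0: "\<And>v. e 0 v = 0"
    and alg: "algebraic (\<lambda>v. - e (- 1) v)"
    and top: "\<And>u a. - e (- 1) u = scale a u \<Longrightarrow> u \<noteq> 0 \<Longrightarrow> Re a \<le> Re c"
    and y: "\<And>i j. e i (y j) = scale (of_int i * c) (y j) + scale (\<rho> + of_int j) (y (i + j) - y j)"
  shows "y j = y 0"
proof -
  define H where "H v = - e (- 1) v" for v
  define X where "X v = e 1 v - H v" for v
  have lin_H: "lin H" unfolding H_def by (rule linI) (simp_all add: lin_simps[OF lin])
  have lin_X: "lin X"
    unfolding X_def by (rule linI) (simp_all add: lin_simps[OF lin] lin_simps[OF lin_H] scale_right_diff_distrib)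
  note simps = lin_simps[OF lin] lin_simps[OF lin_H] lin_simps[OF lin_X]
  \<comment> \<open>\<open>X\<close> raises eigenvalues of \<open>H\<close> by 1.\<close>
  have HX: "H (X v) = X (H v) + X v" for v
    using rel[of 1 "- 1" v] by (simp add: X_def H_def simps e0 algebra_simps)
  have lin_pow: "lin (X ^^ k)" for k
    by (induction k) (auto intro!: linI simp: simps lin_simps)
  have HX_pow: "H ((X ^^ k) v) = (X ^^ k) (H v) + scale (of_nat k) ((X ^^ k) v)" for k v
    by (induction k) (simp_all add: HX simps algebra_simps scale_double)
  obtain as where as: "\<And>w. shift_prod H as w = 0"
    using alg unfolding algebraic_def H_def by blast
  obtain N :: nat where N: "\<And>a. a \<in> set as \<Longrightarrow> Re c < Re a + N"
  proof -
    \<comment> \<open>For empty \<open>as\<close> the value of \<open>Max\<close> is unspecified,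
      but then the bound on \<open>N\<close> is vacuous.\<close>
    obtain N :: nat where "Max ((\<lambda>a. Re c - Re a) ` set as) < N" using reals_Archimedean2 by blast
    then show ?thesis
      using that[of N] Max_ge[of "(\<lambda>a. Re c - Re a) ` set as"] by (fastforce simp: algebra_simps)
  qed
  \<comment> \<open>The roots shifted by \<open>N\<close> have real part above \<open>Re c\<close>,
    so none is an eigenvalue of \<open>H\<close> and the shifted product is injective.\<close>
  have nilpotent: "(X ^^ N) w = 0" for w
  proof (rule shift_prod_injective)
    show "shift_prod H (map (\<lambda>a. a + of_nat N) as) ((X ^^ N) w) = 0"
      by (subst shift_prod_shift[OF lin_pow HX_pow]) (simp add: as lin_simps[OF lin_pow])
    show "u = 0" if "a \<in> set (map (\<lambda>a. a + of_nat N) as)" "H u = scale a u" for u a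
      using top[of u a] N that by (force simp: H_def)
  qed
  have y_Suc: "y j = y (j - 1)" for j
  proof -
    define d where "d = y j - y (j - 1)"
    \<comment> \<open>\<open>c + 1 + k\<close> lies above the extremal eigenvalue, so
      \<open>h k\<close> is injective; \<open>X\<close> intertwines \<open>h k\<close> with
      \<open>h (k + 1)\<close>.\<close>
    define h where "h k v = H v - scale (c + 1 + of_nat k) v" for k v
    have inj: "v = 0" if "h k v = 0" for k v
      using top[of v "c + 1 + of_nat k"] that by (auto simp: h_def H_def)
    have lin_h: "lin (h k)" for k
      unfolding h_def by (rule linI) (simp_all add: simps algebra_simps)
    have Xh: "X (h k v) = h (Suc k) (X v)" for k v
      by (simp add: h_def simps HX algebra_simps scale_double)
    let ?n = "\<rho> + of_int j - 1"
    \<comment> \<open>In the model with \<open>c = 0\<close>, \<open>d\<close> is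
      \<open>x (1 + x)^n\<close>, and \<open>h 0 d + x (h 0 d) = n x d\<close>. Applying
      \<open>h 0\<close> once more leaves only \<open>H\<close> and \<open>X\<close>, which gives
      the case \<open>k = 0\<close>; powers of \<open>X\<close> carry it to all
      \<open>k\<close>.\<close>
    have relation: "h k (h k ((X ^^ k) d)) = scale (?n + 1 + of_nat k) ((X ^^ Suc k) d) - h 0 ((X ^^ Suc k) d)" for k
    proof (induction k)
      case 0
      have H1: "H (y i) = scale (c + \<rho> + of_int i) (y i) - scale (\<rho> + of_int i) (y (i - 1))" for i
        by (simp add: H_def y algebra_simps)
      have e1: "e 1 (y i) = scale (c - \<rho> - of_int i) (y i) + scale (\<rho> + of_int i) (y (i + 1))" for i
        by (simp add: y algebra_simps)
      have X1: "X (y i) = scale (\<rho> + of_int i) (y (i + 1) + y (i - 1) - scale 2 (y i))" for i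
        by (simp add: X_def e1 H1 algebra_simps scale_double)
      show ?case
        unfolding d_def h_def
        by (simp add: simps H1 X1) (simp add: algebra_simps scale_double)
    next
      case (Suc k)
      have "h (Suc k) (h (Suc k) ((X ^^ Suc k) d)) = X (h k (h k ((X ^^ k) d)))" by (simp add: Xh)
      also have "\<dots> = scale (?n + 1 + of_nat k) ((X ^^ Suc (Suc k)) d) - h 1 ((X ^^ Suc (Suc k)) d)"
        unfolding Suc by (simp add: simps Xh)
      also have "\<dots> = scale (?n + 1 + of_nat (Suc k)) ((X ^^ Suc (Suc k)) d) - h 0 ((X ^^ Suc (Suc k)) d)"
        by (simp add: h_def algebra_simps scale_double)
      finally show ?case .
    qed
    \<comment> \<open>If the right side of \<open>relation\<close> vanishes, injectivity of
      \<open>h k\<close>, used twice, gives the claim. Thus nilpotency of \<open>X\<close> descends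
      to \<open>d = 0\<close>.\<close>
    have step: "(X ^^ k) d = 0" if "(X ^^ Suc k) d = 0" for k
      by (rule inj[of k], rule inj[of k])
        (simp only: relation that lin_simps[OF lin_h] scale_zero_right diff_0_right)
    have "(X ^^ (N - k)) d = 0" for k
    proof (induction k)
      case (Suc k)
      show ?case
      proof (cases "k < N")
        case True
        then show ?thesis using Suc by (simp only: step Suc_diff_Suc)
      next
        case False
        then show ?thesis using Suc by simp
      qed
    qed (simp add: nilpotent)
    from this[of N] show ?thesis by (simp add: d_def)
  qed
  show ?thesis
  proof (induction j rule: int_induct[where k = 0])
    case (step1 i)
    then show ?case using y_Suc[of "i + 1"] by simp
  next
    case (step2 i)
    then show ?case using y_Suc[of i] by simp
  qed simp
qed

end

section \<open>The operators of an \<open>\<A>\<gg>'\<close>-module\<close>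

sublocale Ag_module \<subseteq> complex_vector_space scale ..

context Ag_module
begin

abbreviation L :: "int \<Rightarrow> 'v \<Rightarrow> 'v" where
  "L m \<equiv> act (L_gen m)"

abbreviation T :: "int \<Rightarrow> 'v \<Rightarrow> 'v" where
  "T m \<equiv> tact (t_pow m)"

lemma t_pow_laurent [simp]: "p dvd m \<Longrightarrow> t_pow m \<in> laurent p"
  by (simp add: laurent_def t_pow_def)

lemmas L_simps = lin_simps[OF act_linear_right]

lemma T_simps:
  assumes "p dvd m"
  shows "T m (x + y) = T m x + T m y" "T m (x - y) = T m x - T m y" "T m (- x) = - T m x" "T m 0 = 0"
    "T m (scale c x) = scale c (T m x)"
  by (rule lin_simps[OF tact_linear] t_pow_laurent assms)+

lemma T_T: "p dvd m \<Longrightarrow> p dvd n \<Longrightarrow> T m (T n v) = T (m + n) v"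
  by (simp flip: tact_mult t_pow_mult)

lemma T_0 [simp]: "T 0 v = v"
  by (simp add: t_pow_zero tact_one)

lemma L_T: "p dvd m \<Longrightarrow> p dvd n \<Longrightarrow> L m (T n v) = T n (L m v) + scale (of_int n) (T (m + n) v)"
  using act_tact[of m n v] by (simp add: algebra_simps)

lemma L_T': "p dvd n \<Longrightarrow> \<not> p dvd r \<Longrightarrow> L r (T n v) = T n (L r v)"
  by (simp add: tact_act)

lemma L_L: "L m (L n v) = L n (L m v) + scale (of_int (gap_coeff p m n)) (L (m + n) v)"
proof -
  have "gap_bracket p (L_gen m) (L_gen n) = fscale (of_int (gap_coeff p m n)) (L_gen (m + n))"
    by (simp add: L_gen_def gap_bracket_single)
  then show ?thesis
    using act_bracket[of "L_gen m" "L_gen n" v] act_linear_left[of v]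
    by (simp add: Vector_Spaces.linear_iff algebra_simps)
qed

lemma L0_L: "L 0 (L m v) = L m (L 0 v) + scale (of_int m) (L m v)"
  using L_L[of 0 m v] by (simp add: gap_coeff_def)

lemma L0_T: "p dvd m \<Longrightarrow> L 0 (T m v) = T m (L 0 v) + scale (of_int m) (T m v)"
  using L_T[of 0 m v] by simp

lemma Ag_submoduleI:
  assumes W: "V.subspace W" and T: "\<And>m w. p dvd m \<Longrightarrow> w \<in> W \<Longrightarrow> T m w \<in> W"
    and L: "\<And>m w. w \<in> W \<Longrightarrow> L m w \<in> W"
  shows "Ag_submodule W"
  unfolding Ag_submodule_def
proof (intro conjI allI ballI W)
  note W' = V.subspace_0[OF W] V.subspace_add[OF W] V.subspace_scale[OF W]
  show "act x w \<in> W" if w: "w \<in> W" for x w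
  proof -
    have lin: "act (a + b) w = act a w + act b w" "act (fscale c a) w = scale c (act a w)" for a b c
      using act_linear_left[of w] by (simp_all add: Vector_Spaces.linear_iff)
    show ?thesis
    proof (induction x rule: single_add_induct)
      case 1
      show ?case using lin(2)[of 0 0] by (simp add: W')
    next
      case (2 m c)
      show ?case using lin(2)[of c "L_gen m"] W'(3)[OF L[OF w]] by (simp add: L_gen_def)
    next
      case (3 x y)
      then show ?case by (simp add: lin W')
    qed
  qed
  show "tact a w \<in> W" if a: "a \<in> laurent p" and w: "w \<in> W" for a w
  proof -
    have "a \<in> laurent p \<and> tact a w \<in> W"
      using a[unfolded laurent_eq_span]
    proof (induction rule: fscale.span_induct_alt)
      case base
      have "0 \<in> laurent p" by (simp add: laurent_def)
      then show ?case using tact_scale[of 0 0 w] by (simp add: W' fscale.scale_zero_left)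
    next
      case (step c x y)
      then obtain m where m: "p dvd m" "x = t_pow m" by auto
      have "fscale c x \<in> laurent p"
        using m by (auto simp: laurent_def t_pow_def)
      moreover from this have "fscale c x + y \<in> laurent p"
        using step(2) unfolding laurent_eq_span by (intro fscale.span_add) simp_all
      ultimately show ?case
        using step m by (simp add: tact_add tact_scale W' T[OF m(1) w])
    qed
    then show ?thesis ..
  qed
qed

lemma irreducible_UNIV:
  assumes "irreducible_module" "V.subspace W" "\<And>m w. p dvd m \<Longrightarrow> w \<in> W \<Longrightarrow> T m w \<in> W"
    "\<And>m w. w \<in> W \<Longrightarrow> L m w \<in> W" "w \<in> W" "w \<noteq> 0"
  shows "W = UNIV"
  using assms Ag_submoduleI[of W] unfolding irreducible_module_def by blast

section \<open>The weight-preserving parts of the operators \<open>L\<^sub>m\<close>\<close>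

definition E :: "int \<Rightarrow> 'v \<Rightarrow> 'v" where
  "E m v = T (- m) (L m v) - L 0 v"

lemma L_eq_T_E: "p dvd m \<Longrightarrow> L m v = T m (L 0 v + E m v)"
  by (simp add: E_def T_simps T_T)

lemma lin_E: "p dvd m \<Longrightarrow> lin (E m)"
  unfolding E_def by (rule linI) (simp_all add: T_simps L_simps V.scale_right_diff_distrib)

lemmas E_simps = lin_simps[OF lin_E]

lemma E_0 [simp]: "E 0 v = 0"
  by (simp add: E_def)

text \<open>\<open>T (- m)\<close> after \<open>L m\<close> has the same commutator with
  \<open>T n\<close> as \<open>L 0\<close>, namely \<open>n\<close> times
  \<open>T n\<close>.\<close>

lemma E_T: "p dvd m \<Longrightarrow> p dvd n \<Longrightarrow> E m (T n v) = T n (E m v)"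
  by (simp add: E_def L_T T_simps T_T add.commute)

lemma E_L0: "p dvd m \<Longrightarrow> E m (L 0 v) = L 0 (E m v)"
  by (simp add: E_def L0_L[of m] L0_T T_simps L_simps)

lemma E_L: "p dvd m \<Longrightarrow> \<not> p dvd r \<Longrightarrow>
    E m (L r v) = L r (E m v) + scale (of_int r) (T (- m) (L (m + r) v) - L r v)"
  by (simp add: E_def L_L[of m r] L0_L[of r] T_simps L_simps L_T' gap_coeff_def algebra_simps)

text \<open>The commutator of \<open>L m\<close> and \<open>L n\<close> is expanded in two ways with
  all \<open>T\<close> moved to the left; then the invertible operator \<open>T (m + n)\<close> is
  cancelled.\<close>

lemma E_E:
  assumes m: "p dvd m" and n: "p dvd n"
  shows "E m (E n v) - E n (E m v) =
    scale (of_int (n - m)) (E (m + n) v) - scale (of_int n) (E n v) + scale (of_int m) (E m v)"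
proof -
  have mn: "p dvd m + n" using assms by simp
  have LL: "L a (L b v) = T (a + b) (L 0 (L 0 v) + L 0 (E a v) + L 0 (E b v) + E a (E b v)
       + scale (of_int b) (L 0 v + E b v))" if "p dvd a" "p dvd b" for a b
    using that by (simp add: L_eq_T_E[of a] L_eq_T_E[of b] E_T L0_T T_simps E_simps L_simps E_L0 T_T algebra_simps)
  have "T (m + n) (E m (E n v) - E n (E m v) + scale (of_int n) (L 0 v + E n v) - scale (of_int m) (L 0 v + E m v))
      = L m (L n v) - L n (L m v)"
    using assms mn by (simp add: LL[OF m n] LL[OF n m] T_simps add.commute[of n m] algebra_simps)
  also have "\<dots> = T (m + n) (scale (of_int (n - m)) (L 0 v + E (m + n) v))"
    using assms mn by (simp add: L_L[of m n] gap_coeff_def L_eq_T_E[OF mn] T_simps)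
  finally have "T (- (m + n)) (T (m + n) (E m (E n v) - E n (E m v) + scale (of_int n) (L 0 v + E n v) - scale (of_int m) (L 0 v + E m v)))
      = T (- (m + n)) (T (m + n) (scale (of_int (n - m)) (L 0 v + E (m + n) v)))" by simp
  then have "E m (E n v) - E n (E m v) + scale (of_int n) (L 0 v + E n v) - scale (of_int m) (L 0 v + E m v)
      = scale (of_int (n - m)) (L 0 v + E (m + n) v)"
    by (subst (asm) (1 2) T_T) (use m n in simp_all)
  then show ?thesis by (simp add: algebra_simps)
qed

section \<open>Irreducible cuspidal modules\<close>

context
  assumes p: "p > 1" and irr: irreducible_module and cusp: cuspidal
begin

section \<open>Weights modulo \<open>p\<close> and Schur's lemma\<close>

text \<open>All generators shift weights by integers, so the weight spaces of one coset of the
  integers span a submodule.\<close>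

lemma weights_congruent:
  obtains \<kappa> where "V.span (\<Union>n. weight_space (\<kappa> + of_int n)) = UNIV"
proof -
  obtain B where B: "V.span B = UNIV" "\<forall>b\<in>B. \<exists>\<mu>. b \<in> weight_space \<mu>"
    using cusp unfolding cuspidal_def L0_diagonalizable_def by blast
  obtain v :: 'v where "v \<noteq> 0" using irr unfolding irreducible_module_def by blast
  then have "\<not> B \<subseteq> {0}" using B(1) V.span_mono[of B "{0}"] by auto
  then obtain b \<kappa> where b: "b \<noteq> 0" "b \<in> weight_space \<kappa>" using B(2) by blast
  let ?S = "\<Union>n. weight_space (\<kappa> + of_int n)"
  have S: "u \<in> ?S \<longleftrightarrow> (\<exists>n. L 0 u = scale (\<kappa> + of_int n) u)" for u
    by (simp add: weight_space_def)
  have "V.span ?S = UNIV"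
  proof (rule irreducible_UNIV[OF irr V.subspace_span])
    show "T m w \<in> V.span ?S" if "p dvd m" "w \<in> V.span ?S" for m w
    proof (rule span_stable[OF _ _ that(2)])
      show "lin (T m)" using that(1) by (simp add: tact_linear)
      fix u assume "u \<in> ?S"
      then obtain n where "L 0 u = scale (\<kappa> + of_int n) u" unfolding S ..
      then have "L 0 (T m u) = scale (\<kappa> + of_int (n + m)) (T m u)"
        using that(1) by (simp add: L0_T T_simps algebra_simps)
      then have "T m u \<in> ?S" unfolding S by blast
      then show "T m u \<in> V.span ?S" by (rule V.span_base)
    qed
    show "L m w \<in> V.span ?S" if "w \<in> V.span ?S" for m w
    proof (rule span_stable[OF act_linear_right _ that])
      fix u assume "u \<in> ?S"
      then obtain n where "L 0 u = scale (\<kappa> + of_int n) u" unfolding S ..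
      then have "L 0 (L m u) = scale (\<kappa> + of_int (n + m)) (L m u)"
        by (simp add: L0_L[of m] L_simps algebra_simps)
      then have "L m u \<in> ?S" unfolding S by blast
      then show "L m u \<in> V.span ?S" by (rule V.span_base)
    qed
    have "b \<in> ?S" using b(2) unfolding S weight_space_def by (auto intro: exI[of _ 0])
    then show "b \<in> V.span ?S" by (rule V.span_base)
  qed (rule b)
  then show ?thesis by (rule that)
qed

text \<open>\<open>Z\<close> preserves the finite-dimensional weight spaces, and \<open>T\<close>
  identifies those whose weights differ by a multiple of \<open>p\<close>. A list that works for
  \<open>p\<close> consecutive weights therefore works everywhere.\<close>

lemma algebraic_of_commuting:
  assumes Z: "lin Z" and ZT: "\<And>m v. p dvd m \<Longrightarrow> Z (T m v) = T m (Z v)" and ZL: "\<And>v. Z (L 0 v) = L 0 (Z v)"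
  shows "algebraic Z"
proof -
  obtain \<kappa> where \<kappa>: "V.span (\<Union>n. weight_space (\<kappa> + of_int n)) = UNIV" by (rule weights_congruent)
  have "\<exists>as. \<forall>u\<in>weight_space \<mu>. shift_prod Z as u = 0" for \<mu>
  proof -
    obtain B where B: "finite B" "weight_space \<mu> \<subseteq> V.span B"
      using cusp unfolding cuspidal_def finite_dim_def by blast
    have "Z ` weight_space \<mu> \<subseteq> weight_space \<mu>"
      by (auto simp: weight_space_def lin_simps[OF Z] simp flip: ZL)
    then show ?thesis by (rule shift_prod_of_finite_dim[OF Z _ B])
  qed
  then obtain as where as: "\<forall>j\<in>{0..<p}. \<forall>u\<in>weight_space (\<kappa> + of_int j). shift_prod Z as u = 0"
    using shift_prod_common[OF Z, of "{0..<p}" "\<lambda>j. weight_space (\<kappa> + of_int j)"] by auto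
  have weight: "shift_prod Z as u = 0" if "u \<in> weight_space (\<kappa> + of_int n)" for u n
  proof -
    let ?q = "p * (n div p)"
    have dvd: "p dvd ?q" "p dvd - ?q" by auto
    have "L 0 (T (- ?q) u) = scale (\<kappa> + of_int n + of_int (- ?q)) (T (- ?q) u)"
      using that dvd by (simp add: weight_space_def L0_T T_simps algebra_simps)
    moreover have "\<kappa> + of_int n + of_int (- ?q) = \<kappa> + of_int (n mod p)"
      by (subst (1) minus_mult_div_eq_mod[symmetric]) simp
    ultimately have "T (- ?q) u \<in> weight_space (\<kappa> + of_int (n mod p))"
      by (simp only: weight_space_def mem_Collect_eq)
    moreover have "n mod p \<in> {0..<p}" using p by simp
    ultimately have "shift_prod Z as (T (- ?q) u) = 0" using as by blast
    then have "shift_prod Z as (T ?q (T (- ?q) u)) = 0"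
      using dvd(1) by (subst shift_prod_commute[OF tact_linear]) (simp_all add: ZT T_simps)
    then show ?thesis using dvd by (simp add: T_T)
  qed
  have "shift_prod Z as w = 0" if "w \<in> V.span (\<Union>n. weight_space (\<kappa> + of_int n))" for w
    using that
  proof (induction rule: V.span_induct_alt)
    case base
    show ?case by (simp add: lin_simps(4)[OF lin_shift_prod[OF Z]])
  next
    case (step c x y)
    then show ?case using weight by (auto simp: lin_simps(1,5)[OF lin_shift_prod[OF Z]])
  qed
  then show ?thesis unfolding algebraic_def \<kappa> by blast
qed

text \<open>Algebraicity supplies an eigenvalue although the module may be infinite-dimensional; its
  eigenspace is a submodule.\<close>

lemma schur:
  assumes Z: "lin Z" and ZT: "\<And>m v. p dvd m \<Longrightarrow> Z (T m v) = T m (Z v)" and ZL: "\<And>m v. Z (L m v) = L m (Z v)"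
  shows "\<exists>a. \<forall>v. Z v = scale a v"
proof -
  obtain w :: 'v where "w \<noteq> 0" using irr unfolding irreducible_module_def by blast
  then obtain v a where v: "v \<noteq> 0" "Z v = scale a v"
    using algebraic_extremal_eigenvector[OF Z algebraic_of_commuting[OF Z ZT ZL]] by metis
  have "{u. Z u = scale a u} = UNIV"
  proof (rule irreducible_UNIV[OF irr])
    show "V.subspace {u. Z u = scale a u}"
      by (rule V.subspaceI) (simp_all add: lin_simps[OF Z] V.scale_right_distrib mult.commute)
  qed (use v in \<open>simp_all add: ZT ZL T_simps L_simps\<close>)
  then show ?thesis by blast
qed

text \<open>The common kernel of the derived algebra of the weight-preserving Lie algebra. The derived
  algebra is an ideal, so this is a submodule.\<close>

definition derived_kernel :: "'v set" where
  "derived_kernel = {v. (\<forall>m n. p dvd m \<longrightarrow> p dvd n \<longrightarrow> scale (of_int n) (E m v) = scale (of_int m) (E n v))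
      \<and> (\<forall>m r. p dvd m \<longrightarrow> \<not> p dvd r \<longrightarrow> L (m + r) v = T m (L r v))}"

lemma derived_kernelI:
  assumes "\<And>m n. p dvd m \<Longrightarrow> p dvd n \<Longrightarrow> scale (of_int n) (E m u) = scale (of_int m) (E n u)"
    "\<And>m r. p dvd m \<Longrightarrow> \<not> p dvd r \<Longrightarrow> L (m + r) u = T m (L r u)"
  shows "u \<in> derived_kernel"
  using assms unfolding derived_kernel_def by blast

lemma derived_kernelD:
  assumes "u \<in> derived_kernel" "p dvd m"
  shows "p dvd n \<Longrightarrow> scale (of_int n) (E m u) = scale (of_int m) (E n u)"
    and "\<not> p dvd r \<Longrightarrow> L (m + r) u = T m (L r u)"
  using assms unfolding derived_kernel_def by blast+

text \<open>On the vector from \<open>quasi_witt_eigenvector\<close>, \<open>E m\<close> acts by a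
  scalar linear in \<open>m\<close>, which is the first kernel condition. The second comes from
  \<open>tensor_family_constant\<close>.\<close>

lemma derived_kernel_nonzero:
  obtains v where "v \<in> derived_kernel" "v \<noteq> 0"
proof -
  \<comment> \<open>Dividing both the index and the operator by \<open>p\<close> turns
    \<open>E_E\<close> into the relation \<open>rel\<close> over all integers.\<close>
  define e where "e j v = scale (1 / of_int p) (E (p * j) v)" for j v
  have p0: "(of_int p :: complex) \<noteq> 0" using p by simp
  have lin_e: "lin (e j)" for j
    unfolding e_def by (rule linI) (simp_all add: E_simps V.scale_right_distrib)
  have E_e: "E (p * j) v = scale (of_int p) (e j v)" for j v
    using p0 by (simp add: e_def)
  have rel: "e i (e j v) - e j (e i v) =
      scale (of_int (j - i)) (e (i + j) v) - scale (of_int j) (e j v) + scale (of_int i) (e i v)" for i j v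
  proof -
    have "e i (e j v) - e j (e i v) = scale (1 / of_int p * (1 / of_int p)) (E (p * i) (E (p * j) v) - E (p * j) (E (p * i) v))"
      by (simp add: e_def E_simps V.scale_right_diff_distrib)
    also have "E (p * i) (E (p * j) v) - E (p * j) (E (p * i) v) =
        scale (of_int (p * (j - i))) (E (p * (i + j)) v) - scale (of_int (p * j)) (E (p * j) v)
        + scale (of_int (p * i)) (E (p * i) v)"
      using E_E[of "p * i" "p * j" v] by (simp add: distrib_left right_diff_distrib)
    also have "\<dots> = scale (of_int p * of_int p)
        (scale (of_int (j - i)) (e (i + j) v) - scale (of_int j) (e j v) + scale (of_int i) (e i v))"
      by (simp only: E_e) (simp add: V.scale_right_distrib V.scale_right_diff_distrib mult_ac)
    finally show ?thesis using p0 by simp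
  qed
  have e0: "e 0 v = 0" for v by (simp add: e_def)
  have eT: "e j (T m v) = T m (e j v)" if "p dvd m" for j m v
    using that by (simp add: e_def E_T T_simps)
  have eL: "e j (L 0 v) = L 0 (e j v)" for j v
    by (simp add: e_def E_L0 L_simps)
  have alg: "algebraic (e 1)" "algebraic (\<lambda>v. - e (- 1) v)"
    by (rule algebraic_of_commuting;
        (rule linI)?; simp add: lin_simps[OF lin_e] eT eL T_simps L_simps lin_e)+
  obtain w :: 'v where "w \<noteq> 0" using irr unfolding irreducible_module_def by blast
  then obtain v c where v: "v \<noteq> 0" "\<And>j. e j v = scale (of_int j * c) v"
    and top: "\<And>u a. - e (- 1) u = scale a u \<Longrightarrow> u \<noteq> 0 \<Longrightarrow> Re a \<le> Re c"
    using quasi_witt_eigenvector[OF lin_e rel e0 alg] by metis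
  have Lv: "L (p * j + r) v = T (p * j) (L r v)" if r: "\<not> p dvd r" for j r
  proof -
    \<comment> \<open>All \<open>y j\<close> arise from \<open>v\<close> by operators of the same
      weight \<open>r\<close>. \<open>E_L\<close> gives the hypothesis of
      \<open>tensor_family_constant\<close> with \<open>\<rho> = r / p\<close>, and
      \<open>y j = y 0\<close> is the claim.\<close>
    define y where "y j = T (- (p * j)) (L (p * j + r) v)" for j
    have "e i (y j) = scale (of_int i * c) (y j) + scale (of_int r / of_int p + of_int j) (y (i + j) - y j)" for i j
    proof -
      let ?s = "p * j + r"
      have s: "\<not> p dvd ?s" using r by (simp add: dvd_add_right_iff)
      have "E (p * i) (y j) = T (- (p * j)) (L ?s (E (p * i) v)
          + scale (of_int ?s) (T (- (p * i)) (L (p * i + ?s) v) - L ?s v))"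
        by (simp add: y_def E_T E_L[OF _ s])
      also have "E (p * i) v = scale (of_int p * (of_int i * c)) v"
        by (simp add: E_e v(2))
      also have "T (- (p * j)) (L ?s (scale (of_int p * (of_int i * c)) v)
          + scale (of_int ?s) (T (- (p * i)) (L (p * i + ?s) v) - L ?s v)) =
          scale (of_int p * (of_int i * c)) (y j) + scale (of_int ?s) (y (i + j) - y j)"
        by (simp add: y_def L_simps T_simps T_T algebra_simps)
      finally have "e i (y j) = scale (1 / of_int p * (of_int p * (of_int i * c))) (y j)
          + scale (1 / of_int p * of_int ?s) (y (i + j) - y j)"
        by (simp only: e_def V.scale_right_distrib V.scale_scale)
      moreover have "1 / of_int p * of_int ?s = of_int r / of_int p + (of_int j :: complex)"
        using p0 by (simp add: field_simps)
      ultimately show ?thesis using p0 by simp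
    qed
    then have "y j = y 0" by (intro tensor_family_constant[OF lin_e rel e0 alg(2) top])
    then have "T (p * j) (y j) = T (p * j) (L r v)" by (simp add: y_def)
    then show ?thesis by (simp add: y_def T_T)
  qed
  have "v \<in> derived_kernel"
  proof (rule derived_kernelI)
    show "scale (of_int n) (E m v) = scale (of_int m) (E n v)" if m: "p dvd m" and n: "p dvd n" for m n
    proof -
      obtain i j where "m = p * i" "n = p * j" using m n unfolding dvd_def by blast
      then show ?thesis by (simp only: E_e v(2)) (simp add: mult_ac)
    qed
    show "L (m + r) v = T m (L r v)" if "p dvd m" "\<not> p dvd r" for m r
      using that unfolding dvd_def[of p m] by (auto simp: Lv)
  qed
  then show ?thesis using v(1) by (rule that)
qed

lemma derived_kernel_UNIV: "derived_kernel = UNIV"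
proof -
  have p0: "(of_int p :: complex) \<noteq> 0" using p by simp
  note W_E = derived_kernelD(1) and W_L = derived_kernelD(2)
  have sub: "V.subspace derived_kernel"
  proof (rule V.subspaceI)
    show "0 \<in> derived_kernel" by (rule derived_kernelI) (simp_all add: E_simps L_simps T_simps)
    show "x + y \<in> derived_kernel" if "x \<in> derived_kernel" "y \<in> derived_kernel" for x y
      by (rule derived_kernelI) (simp_all add: that E_simps L_simps T_simps W_L V.scale_right_distrib W_E[of _ m n for m n] W_E[OF that(1)] W_E[OF that(2)])
    show "scale a x \<in> derived_kernel" if "x \<in> derived_kernel" for a x
      by (rule derived_kernelI) (simp_all add: that E_simps L_simps T_simps W_L V.scale_left_commute[of _ a] W_E del: V.scale_scale)
  qed
  have W_T: "T k u \<in> derived_kernel" if k: "p dvd k" and u: "u \<in> derived_kernel" for k u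
  proof (rule derived_kernelI)
    show "scale (of_int n) (E m (T k u)) = scale (of_int m) (E n (T k u))" if "p dvd m" "p dvd n" for m n
      using W_E[OF u that] that k by (simp add: E_T flip: T_simps)
    show "L (m + r) (T k u) = T m (L r (T k u))" if "p dvd m" "\<not> p dvd r" for m r
      using W_L[OF u that] that k by (simp add: L_T' T_T dvd_add_right_iff add.commute)
  qed
  \<comment> \<open>The second kernel condition cancels the correction term of
    \<open>E_L\<close>.\<close>
  have W_EL: "E m (L r u) = L r (E m u)" if "u \<in> derived_kernel" "p dvd m" "\<not> p dvd r" for u m r
    using that by (simp add: E_L W_L T_T)
  have W_Lr: "L s u \<in> derived_kernel" if s: "\<not> p dvd s" and u: "u \<in> derived_kernel" for s u
  proof (rule derived_kernelI)
    show "scale (of_int n) (E m (L s u)) = scale (of_int m) (E n (L s u))" if "p dvd m" "p dvd n" for m n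
      using W_E[OF u that] that s u by (simp add: W_EL flip: L_simps)
    show "L (m + r) (L s u) = T m (L r (L s u))" if "p dvd m" "\<not> p dvd r" for m r
    proof -
      have "L (m + r) (L s u) = L s (L (m + r) u)" "L r (L s u) = L s (L r u)"
        using that s by (simp_all add: L_L[of _ s] gap_coeff_def dvd_add_right_iff)
      then show ?thesis using W_L[OF u that] that s by (simp add: L_T')
    qed
  qed
  have W_L0: "L 0 u \<in> derived_kernel" if u: "u \<in> derived_kernel" for u
  proof (rule derived_kernelI)
    show "scale (of_int n) (E m (L 0 u)) = scale (of_int m) (E n (L 0 u))" if "p dvd m" "p dvd n" for m n
      using W_E[OF u that] that by (simp add: E_L0 flip: L_simps)
    show "L (m + r) (L 0 u) = T m (L r (L 0 u))" if "p dvd m" "\<not> p dvd r" for m r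
    proof -
      have L0: "L s (L 0 u) = L 0 (L s u) - scale (of_int s) (L s u)" for s
        using L0_L[of s u] by simp
      show ?thesis
        using W_L[OF u that] that(1) by (simp add: L0 L0_T T_simps algebra_simps)
    qed
  qed
  have W_Ek: "E k u \<in> derived_kernel" if k: "p dvd k" and u: "u \<in> derived_kernel" for k u
  proof (rule derived_kernelI)
    have comm: "E m (E k u) = E k (E m u)" if m: "p dvd m" for m
    proof -
      have E: "E m u = scale (of_int m) (scale (1 / of_int p) (E p u))" if "p dvd m" for m
      proof -
        have "E m u = scale (1 / of_int p) (scale (of_int p) (E m u))" using p0 by simp
        also have "\<dots> = scale (1 / of_int p) (scale (of_int m) (E p u))"
          using W_E[OF u that, of p] by simp
        finally show ?thesis by (simp add: mult.commute)
      qed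
      have "p dvd m + k" using m k by simp
      note E = E[OF m] E[OF k] E[OF this]
      \<comment> \<open>With \<open>E m u\<close> proportional to \<open>m\<close>, this is the
        identity \<open>(k - m)(m + k) - k^2 + m^2 = 0\<close>.\<close>
      have "scale (of_int (k - m)) (E (m + k) u) - scale (of_int k) (E k u) + scale (of_int m) (E m u) = 0"
        unfolding E by (simp flip: V.scale_left_distrib V.scale_left_diff_distrib)
            (simp add: algebra_simps add_divide_distrib diff_divide_distrib)
      then show ?thesis using E_E[OF m k, of u] by simp
    qed
    show "scale (of_int n) (E m (E k u)) = scale (of_int m) (E n (E k u))" if "p dvd m" "p dvd n" for m n
      using W_E[OF u that] that k by (simp add: comm flip: E_simps)
    show "L (m + r) (E k u) = T m (L r (E k u))" if "p dvd m" "\<not> p dvd r" for m r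
    proof -
      have "\<not> p dvd m + r" using that by (simp add: dvd_add_right_iff)
      then show ?thesis using that W_L[OF u that] k u by (simp add: E_T flip: W_EL)
    qed
  qed
  obtain v where v: "v \<in> derived_kernel" "v \<noteq> 0" by (rule derived_kernel_nonzero)
  show ?thesis
  proof (rule irreducible_UNIV[OF irr sub W_T _ v])
    show "L m u \<in> derived_kernel" if "u \<in> derived_kernel" for m u
    proof (cases "p dvd m")
      case True
      then show ?thesis
        unfolding L_eq_T_E[OF True] by (intro W_T V.subspace_add[OF sub] W_L0 W_Ek that)
    qed (simp add: W_Lr that)
  qed
qed

section \<open>Commuting operators and their scalars\<close>

lemma L_add: "p dvd m \<Longrightarrow> \<not> p dvd r \<Longrightarrow> L (m + r) v = T m (L r v)"
  using derived_kernelD(2)[of v m r] by (simp add: derived_kernel_UNIV)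

lemma E_L_commute: "p dvd m \<Longrightarrow> \<not> p dvd r \<Longrightarrow> E m (L r v) = L r (E m v)"
  by (simp add: E_L L_add T_T)

lemma schur':
  assumes Z: "lin Z" and ZT: "\<And>m v. p dvd m \<Longrightarrow> Z (T m v) = T m (Z v)" and ZL0: "\<And>v. Z (L 0 v) = L 0 (Z v)"
    and ZE: "\<And>m v. p dvd m \<Longrightarrow> Z (E m v) = E m (Z v)" and ZL: "\<And>r v. \<not> p dvd r \<Longrightarrow> Z (L r v) = L r (Z v)"
  shows "\<exists>a. \<forall>v. Z v = scale a v"
proof (rule schur[OF Z ZT])
  show "Z (L m v) = L m (Z v)" for m v
    by (cases "p dvd m") (simp_all add: L_eq_T_E[of m] ZT lin_simps[OF Z] ZL0 ZE ZL)
qed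

text \<open>All \<open>E m\<close> are multiples of \<open>E p\<close>, so they commute with each
  other and \<open>schur'\<close> applies.\<close>

lemma E_scalar:
  assumes k: "p dvd k"
  shows "\<exists>a. \<forall>v. E k v = scale a v"
proof (rule schur'[OF lin_E[OF k]])
  have E: "E m v = scale (of_int m) (scale (1 / of_int p) (E p v))" if "p dvd m" for m v
  proof -
    have "scale (of_int p) (E m v) = scale (of_int m) (E p v)"
      using that by (intro derived_kernelD(1)) (simp_all add: derived_kernel_UNIV)
    then have "scale (1 / of_int p) (scale (of_int p) (E m v)) = scale (1 / of_int p) (scale (of_int m) (E p v))"
      by simp
    then show ?thesis using p by (simp add: mult.commute)
  qed
  show "E k (E m v) = E m (E k v)" if "p dvd m" for m v
    by (simp add: E[OF k] E[OF that] E_simps mult_ac)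
qed (simp_all add: k E_T E_L0 E_L_commute)

section \<open>Monomials and the dimension of weight spaces\<close>

text \<open>The index is the amount by which the operator shifts weights. \<open>L m\<close> with
  \<open>p dvd m\<close> is left out, being composed of \<open>T m\<close>, \<open>L 0\<close> and a
  scalar.\<close>

inductive monomial :: "int \<Rightarrow> ('v \<Rightarrow> 'v) \<Rightarrow> bool" where
  id: "monomial 0 (\<lambda>v. v)"
| T: "monomial n X \<Longrightarrow> p dvd m \<Longrightarrow> monomial (n + m) (\<lambda>v. T m (X v))"
| L: "monomial n X \<Longrightarrow> \<not> p dvd r \<Longrightarrow> monomial (n + r) (\<lambda>v. L r (X v))"

lemma monomial_lin: "monomial n X \<Longrightarrow> lin X"
  by (induction rule: monomial.induct) (auto intro!: linI simp: lin_simps T_simps L_simps)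

lemma monomial_weight: "monomial n X \<Longrightarrow> L 0 (X v) = X (L 0 v) + scale (of_int n) (X v)"
  by (induction rule: monomial.induct)
    (simp_all add: L0_T T_simps L0_L[of r for r] L_simps algebra_simps)

lemma monomial_commute:
  assumes "monomial n X"
  shows "p dvd m \<Longrightarrow> X (T m v) = T m (X v)" "p dvd m \<Longrightarrow> X (E m v) = E m (X v)"
    "\<not> p dvd s \<Longrightarrow> X (L s v) = L s (X v)"
  using assms
  by (induction rule: monomial.induct)
    (simp_all add: T_T add.commute L_T' E_T E_L_commute L_L[of _ s] gap_coeff_def)

lemma monomial_scalar:
  assumes "monomial 0 X"
  shows "\<exists>a. \<forall>v. X v = scale a v"
  by (rule schur'[OF monomial_lin[OF assms] monomial_commute(1)[OF assms] _
    monomial_commute(2,3)[OF assms]]) (simp_all add: monomial_weight[OF assms])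

text \<open>\<open>T m\<close> and the \<open>L r\<close> with \<open>r\<close> not divisible by
  \<open>p\<close> extend monomials, \<open>L 0\<close> scales each vector \<open>X v\<close>, and
  \<open>E m\<close> is a scalar; so the span is a submodule.\<close>

lemma span_monomials:
  assumes v: "v \<in> weight_space \<mu>" "v \<noteq> 0"
  shows "V.span {X v |n X. monomial n X} = UNIV"
proof (rule irreducible_UNIV[OF irr V.subspace_span])
  let ?S = "{X v |n X. monomial n X}"
  show "v \<in> V.span ?S" by (rule V.span_base) (use monomial.id in fast)
  show T: "T m w \<in> V.span ?S" if "p dvd m" "w \<in> V.span ?S" for m w
  proof (rule span_stable[OF _ _ that(2)])
    show "lin (T m)" using that(1) by (simp add: tact_linear)
    show "T m u \<in> V.span ?S" if "u \<in> ?S" for u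
    proof (rule V.span_base)
      show "T m u \<in> ?S" using \<open>u \<in> ?S\<close> monomial.T[OF _ \<open>p dvd m\<close>] by fast
    qed
  qed
  show "L m w \<in> V.span ?S" if w: "w \<in> V.span ?S" for m w
  proof (cases "p dvd m")
    case True
    have "L 0 w \<in> V.span ?S"
    proof (rule span_stable[OF act_linear_right _ w])
      fix u assume "u \<in> ?S"
      then obtain n X where u: "monomial n X" "u = X v" by blast
      have "L 0 u = scale (\<mu> + of_int n) u"
        using v(1) monomial_weight[OF u(1), of v] lin_simps(5)[OF monomial_lin[OF u(1)]]
        by (simp add: weight_space_def u(2) V.scale_left_distrib)
      then show "L 0 u \<in> V.span ?S" using \<open>u \<in> ?S\<close> by (simp add: V.span_scale V.span_base)
    qed
    moreover obtain a where "E m w = scale a w" using E_scalar[OF True] by blast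
    ultimately show ?thesis
      unfolding L_eq_T_E[OF True] using w by (intro T True V.span_add) (simp_all add: V.span_scale)
  next
    case False
    show ?thesis
    proof (rule span_stable[OF act_linear_right _ w])
      show "L m u \<in> V.span ?S" if "u \<in> ?S" for u
      proof (rule V.span_base)
        show "L m u \<in> ?S" using that monomial.L[OF _ False] by fast
      qed
    qed
  qed
qed (rule v)

text \<open>Monomials of weight 0 contribute multiples of \<open>v\<close>, all others lead to
  weights different from \<open>\<mu>\<close>. The list \<open>as\<close> collects those weights and
  replaces an explicit weight decomposition.\<close>

lemma weight_space_subset_line:
  assumes v: "v \<in> weight_space \<mu>" "v \<noteq> 0"
  shows "weight_space \<mu> \<subseteq> V.span {v}"
proof
  fix w assume w: "w \<in> weight_space \<mu>"
  have lin: "lin (L 0)" by (rule act_linear_right)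
  note simps = lin_simps[OF lin_shift_prod[OF lin]]
  have "\<exists>a as. \<mu> \<notin> set as \<and> shift_prod (L 0) as (u - scale a v) = 0"
    if "u \<in> V.span {X v |n X. monomial n X}" for u
    using that
  proof (induction rule: V.span_induct_alt)
    case base
    show ?case by (intro exI[of _ 0] exI[of _ "[]"]) simp
  next
    case (step c x y)
    then obtain n X a as where X: "monomial n X" "x = X v"
      and as: "\<mu> \<notin> set as" "shift_prod (L 0) as (y - scale a v) = 0" by blast
    show ?case
    proof (cases "n = 0")
      case True
      then obtain b where "x = scale b v" using monomial_scalar[of X] X by auto
      then have eq: "scale c x + y - scale (c * b + a) v = y - scale a v"
        by (simp add: V.scale_left_distrib)
      then show ?thesis using as by (intro exI[of _ "c * b + a"] exI[of _ as]) (simp only: eq simp_thms)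
    next
      case False
      have "L 0 x = scale (\<mu> + of_int n) x"
        using v(1) monomial_weight[OF X(1), of v] lin_simps(5)[OF monomial_lin[OF X(1)]]
        by (simp add: weight_space_def X(2) V.scale_left_distrib)
      then have "shift_prod (L 0) ((\<mu> + of_int n) # as) (scale c x) = 0"
        by (simp add: L_simps V.scale_left_commute simps)
      moreover have "shift_prod (L 0) ([\<mu> + of_int n] @ as) (y - scale a v) = 0"
        unfolding shift_prod_append shift_prod_swap[OF lin, of as] as(2) by (rule simps(4))
      ultimately have "shift_prod (L 0) ((\<mu> + of_int n) # as) (scale c x + (y - scale a v)) = 0"
        by (simp only: simps(1) append.simps add_0_left)
      then show ?thesis
        using False as(1) by (intro exI[of _ a] exI[of _ "(\<mu> + of_int n) # as"]) (simp add: algebra_simps)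
    qed
  qed
  then obtain a as where as: "\<mu> \<notin> set as" "shift_prod (L 0) as (w - scale a v) = 0"
    unfolding span_monomials[OF v] by blast
  have "L 0 (w - scale a v) = scale \<mu> (w - scale a v)"
    using v w by (simp add: weight_space_def L_simps V.scale_right_diff_distrib mult.commute)
  \<comment> \<open>The scalar is nonzero because \<open>\<mu>\<close> does not occur in
    \<open>as\<close>.\<close>
  then have "scale (\<Prod>b\<leftarrow>as. \<mu> - b) (w - scale a v) = 0"
    using shift_prod_eigenvector[OF lin, of "w - scale a v" \<mu> as] as(2) by simp
  then have "w = scale a v" using as(1) by (auto simp: prod_list_zero_iff)
  then show "w \<in> V.span {v}" by (simp add: V.span_base V.span_scale)
qed

lemma intermediate_series_of_cuspidal: "intermediate_series"
  unfolding intermediate_series_def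
proof (intro allI)
  fix \<mu>
  obtain v where v: "weight_space \<mu> \<subseteq> V.span {v}"
  proof (cases "\<exists>v\<in>weight_space \<mu>. v \<noteq> 0")
    case True
    then show ?thesis using weight_space_subset_line that by blast
  next
    case False
    \<comment> \<open>A zero weight space lies in the span of the zero vector, and
      \<open>card {v}\<close> is still 1.\<close>
    then show ?thesis using that[of 0] by auto
  qed
  have "V.dim (weight_space \<mu>) \<le> card {v}" by (rule V.dim_le_card[OF v]) simp
  then show "finite_dim (weight_space \<mu>) \<and> V.dim (weight_space \<mu>) \<le> 1"
    unfolding finite_dim_def using v by (auto intro!: exI[of _ "{v}"])
qed

end

end

theorem theorem3p7:
  fixes p :: int
    and scale :: "complex \<Rightarrow> 'v::ab_group_add \<Rightarrow> 'v"
    and act tact :: "(int \<Rightarrow>\<^sub>0 complex) \<Rightarrow> 'v \<Rightarrow> 'v"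
  assumes "p > 1"
    and "Ag_module p scale act tact"
    and "Ag_module.irreducible_module p scale act tact"
    and "Ag_module.cuspidal scale act"
  shows "Ag_module.intermediate_series scale act"
  using assms by (intro Ag_module.intermediate_series_of_cuspidal)

end
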